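(* Let $d\ge 0$ be a real number that is not an odd integer, let $n\geq 2$ be an integer, and let $C=\mathrm{circ}_n(c_0,c_1,\ldots,c_{n-1})$ be a Hermitian circulant matrix such that $c_0=d$, $c_j\in\{1,-1,\mathrm{i},-\mathrm{i}\}$ for all $j=1,\ldots,n-1$, and $CC^*=(d^2+n-1)I$. Then $n=2d+2$. Moreover, $C$ is real and takes the following form: \begin{itemize} \item if $d$ is an even integer, then $C=\mathrm{circ}_{2d+2}(d,-1,-1,\ldots,-1)$ or $C=\mathrm{circ}_{2d+2}(d,1,-1,1,-1,1,\ldots,-1,1)$ (in the latter, the off-diagonal entries alternate, $c_j=(-1)^{j+1}$ for $j=1,\ldots,2d+1$); \item if $d$ is a half-integer, then $C=\mathrm{circ}_{2d+2}(d,-1,-1,\ldots,-1)$. \end{itemize}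
   Context: For complex numbers $c_0,\ldots,c_{n-1}$, $\mathrm{circ}_n(c_0,c_1,\ldots,c_{n-1})$ denotes the $n\times n$ circulant matrix with first row (generator) $(c_0,c_1,\ldots,c_{n-1})$, i.e. with rows and columns indexed by $0,\ldots,n-1$ its $(r,s)$ entry is $c_{(s-r)\bmod n}$. $C^*$ is the conjugate transpose and $I$ the identity matrix. A half-integer is a number $d$ such that $2d$ is an odd integer. *)

theory Defs
  imports "Jordan_Normal_Form.Schur_Decomposition"
begin

text \<open>The first row is given by a function on the naturals; only its values at
  \<open>0, \<dots>, n - 1\<close> matter.  The difference is formed over the integers
  so that it does not truncate.\<close>

definition circ :: "nat \<Rightarrow> (nat \<Rightarrow> 'a) \<Rightarrow> 'a mat" where
  "circ n c = mat n n (\<lambda>(r, s). c (nat ((int s - int r) mod int n)))"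

definition hermitian :: "complex mat \<Rightarrow> bool" where
  "hermitian A \<longleftrightarrow> mat_adjoint A = A"

definition half_integer :: "real \<Rightarrow> bool" where
  "half_integer d \<longleftrightarrow> (\<exists>k::int. odd k \<and> 2 * d = of_int k)"

end

theory Submission
  imports Defs
begin

text \<open>
  Since \<open>C\<close> is Hermitian, \<open>C\<^sup>2 = (d\<^sup>2 + n - 1) I\<close>, so the generator has vanishing
  autocorrelations.  Grouping the terms of the \<open>s\<close>-th one into the orbits of \<open>j \<mapsto> s - j\<close> gives
  \<open>2 d c\<^sub>s + (\<Sum> 2 j = s. c\<^sub>j\<^sup>2) + 2 (\<Sum> {j, s - j}. c\<^sub>j c\<^sub>s\<^sub>-\<^sub>j) = 0\<close>, which is read modulo powers of
  \<open>1 + \<i>\<close> in the Gaussian integers.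

  If \<open>n\<close> is odd, there is one square; modulo 2 the entries are real, modulo 4 they are all equal.

  If \<open>n = 2 m\<close>, the equation for \<open>s = 1\<close> shows that \<open>d\<close> is an even integer and \<open>m\<close> is odd.  For odd \<open>s\<close>
  there are no squares, and the pairs multiply up to \<open>P / c\<^sub>s\<close> with \<open>P\<close> the product of all
  off-diagonal entries.  Units congruent to 1 modulo \<open>p\<close> satisfy
  sum = number - 1 + product modulo \<open>p\<^sup>2\<close>.  With \<open>p = 1 + \<i>\<close> this makes the
  \<open>c\<^sub>s\<close>, \<open>s\<close> odd, real, as \<open>c\<^sub>m\<close> is; even \<open>s\<close> then give the reality of the rest, and \<open>p = 2\<close> makes the
  \<open>c\<^sub>s\<close>, \<open>s\<close> odd, equal to one sign \<open>u\<close>.  Hence the entries of even index sum to 0, so that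
  \<open>(m u)\<^sup>2 = (\<Sum> c\<^sub>j)\<^sup>2 = d\<^sup>2 + n - 1\<close>, that is, \<open>d = m - 1\<close>; the \<open>m - 1\<close> signs of nonzero even index sum
  to \<open>- d\<close> and are therefore all \<open>-1\<close>.
\<close>

section \<open>Divisibility in the Gaussian integers\<close>

definition gauss_ints :: "complex set" where
  "gauss_ints = {z. Re z \<in> \<int> \<and> Im z \<in> \<int>}"

text \<open>Divisibility in the Gaussian integers, stated on \<open>complex\<close> so that the
  entries of the generator can be used as they are.\<close>

definition gdvd :: "complex \<Rightarrow> complex \<Rightarrow> bool" where
  "gdvd p a \<longleftrightarrow> (\<exists>w\<in>gauss_ints. a = p * w)"

definition gauss_units :: "complex set" where
  "gauss_units = {1, -1, \<i>, -\<i>}"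

lemma gauss_ints_add: "a \<in> gauss_ints \<Longrightarrow> b \<in> gauss_ints \<Longrightarrow> a + b \<in> gauss_ints"
  and gauss_ints_minus: "a \<in> gauss_ints \<Longrightarrow> - a \<in> gauss_ints"
  and gauss_ints_diff: "a \<in> gauss_ints \<Longrightarrow> b \<in> gauss_ints \<Longrightarrow> a - b \<in> gauss_ints"
  and gauss_ints_mult: "a \<in> gauss_ints \<Longrightarrow> b \<in> gauss_ints \<Longrightarrow> a * b \<in> gauss_ints"
  and gauss_ints_of_int: "of_int k \<in> gauss_ints"
  by (auto simp: gauss_ints_def)

lemma gauss_ints_sum: "(\<And>x. x \<in> A \<Longrightarrow> f x \<in> gauss_ints) \<Longrightarrow> sum f A \<in> gauss_ints"
  by (auto simp: gauss_ints_def intro!: Ints_sum)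

lemma gauss_ints_of_real: "complex_of_real x \<in> gauss_ints \<longleftrightarrow> x \<in> \<int>"
  by (auto simp: gauss_ints_def)

lemma gdvd_add: "gdvd p a \<Longrightarrow> gdvd p b \<Longrightarrow> gdvd p (a + b)"
  unfolding gdvd_def by (metis gauss_ints_add distrib_left)

lemma gdvd_minus: "gdvd p a \<Longrightarrow> gdvd p (- a)"
  unfolding gdvd_def by (metis gauss_ints_minus mult_minus_right)

lemma gdvd_diff: "gdvd p a \<Longrightarrow> gdvd p b \<Longrightarrow> gdvd p (a - b)"
  using gdvd_add[of p a "- b"] gdvd_minus[of p b] by simp

lemma gdvd_mult: "gdvd p a \<Longrightarrow> b \<in> gauss_ints \<Longrightarrow> gdvd p (a * b)"
  unfolding gdvd_def by (metis gauss_ints_mult mult.assoc)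

lemma gdvd_mult_left: "gdvd (p * q) a \<Longrightarrow> q \<in> gauss_ints \<Longrightarrow> gdvd p a"
  unfolding gdvd_def by (metis gauss_ints_mult mult.assoc)

lemma gdvd_mult2: "gdvd p a \<Longrightarrow> b \<in> gauss_ints \<Longrightarrow> gdvd p (b * a)"
  using gdvd_mult by (simp add: mult.commute)

lemma gdvd_mult_mono: "gdvd p a \<Longrightarrow> gdvd q b \<Longrightarrow> gdvd (p * q) (a * b)"
  unfolding gdvd_def by (metis gauss_ints_mult mult.assoc mult.left_commute)

lemma gdvd_triv: "a \<in> gauss_ints \<Longrightarrow> gdvd p (p * a)"
  unfolding gdvd_def by auto

lemma gdvd_0: "gdvd p 0"
  using gauss_ints_of_int[of 0] gdvd_triv[of 0 p] by simp

lemma gdvd_sum: "(\<And>x. x \<in> A \<Longrightarrow> gdvd p (f x)) \<Longrightarrow> gdvd p (sum f A)"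
  by (induction A rule: infinite_finite_induct) (auto intro: gdvd_0 gdvd_add)

text \<open>Taking real parts turns a Gaussian quotient into an integer one. Gaussian congruences
  are refuted by passing to integers in this way.\<close>

lemma gdvd_of_int_iff: "gdvd (of_int m) (of_int k) \<longleftrightarrow> m dvd k"
proof
  assume "gdvd (of_int m) (of_int k)"
  then obtain w where w: "w \<in> gauss_ints" "of_int k = of_int m * w"
    by (auto simp: gdvd_def)
  then obtain a where "Re w = of_int a" by (auto simp: gauss_ints_def elim: Ints_cases)
  then have "real_of_int k = of_int m * of_int a" using arg_cong[OF w(2), of Re] by simp
  then have "k = m * a" by (metis of_int_eq_iff of_int_mult)
  then show "m dvd k" by simp
next
  assume "m dvd k"
  then obtain a where "k = m * a" by blast
  then show "gdvd (of_int m) (of_int k)"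
    using gdvd_triv[OF gauss_ints_of_int, of "of_int m" a] by simp
qed

text \<open>\<open>1 + \<i>\<close> is the prime above 2: real and imaginary parts force the
  quotient to be \<open>a * (1 - \<i>)\<close>, and
  \<open>(1 + \<i>) * (1 - \<i>) = 2\<close>.\<close>

lemma gdvd_of_int_prime: "gdvd (1 + \<i>) (of_int k) \<longleftrightarrow> even k"
proof
  assume "gdvd (1 + \<i>) (of_int k)"
  then obtain w where w: "w \<in> gauss_ints" "of_int k = (1 + \<i>) * w"
    by (auto simp: gdvd_def)
  then obtain a b where ab: "Re w = of_int a" "Im w = of_int b"
    by (auto simp: gauss_ints_def elim!: Ints_cases)
  have "real_of_int k = of_int a - of_int b" "(0::real) = of_int a + of_int b"
    using arg_cong[OF w(2), of Re] arg_cong[OF w(2), of Im] ab by auto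
  then have "real_of_int k = of_int (2 * a)" by simp
  then show "even k" by (metis dvd_triv_left of_int_eq_iff)
next
  assume "even k"
  then obtain a where "k = 2 * a" by blast
  then have "of_int k = (1 + \<i>) * ((1 - \<i>) * of_int a)" by (simp add: algebra_simps)
  moreover have "(1 - \<i>) * of_int a \<in> gauss_ints" by (auto simp: gauss_ints_def)
  ultimately show "gdvd (1 + \<i>) (of_int k)" unfolding gdvd_def by blast
qed

section \<open>Units of the Gaussian integers and their residues\<close>

lemma gauss_units_ints: "u \<in> gauss_units \<Longrightarrow> u \<in> gauss_ints"
  by (auto simp: gauss_units_def gauss_ints_def)

lemma gauss_units_mult: "u \<in> gauss_units \<Longrightarrow> v \<in> gauss_units \<Longrightarrow> u * v \<in> gauss_units"
  by (auto simp: gauss_units_def)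

lemma gauss_units_prod: "(\<And>x. x \<in> A \<Longrightarrow> f x \<in> gauss_units) \<Longrightarrow> prod f A \<in> gauss_units"
proof (induction A rule: infinite_finite_induct)
  case (insert x F)
  then show ?case by (simp add: gauss_units_mult)
qed (simp_all add: gauss_units_def)

lemma gauss_units_cnj: "u \<in> gauss_units \<Longrightarrow> u * cnj u = 1" "u \<in> gauss_units \<Longrightarrow> cnj u \<in> gauss_units"
  by (auto simp: gauss_units_def)

lemma gauss_units_square: "u \<in> gauss_units \<Longrightarrow> u\<^sup>2 \<in> {1, -1}"
  by (auto simp: gauss_units_def)

text \<open>The residue field of \<open>1 + \<i>\<close> has two elements, so all units agree there;
  the proof lists the four quotients.\<close>

lemma gauss_units_cong_1:
  assumes "u \<in> gauss_units"
  shows "gdvd (1 + \<i>) (u - 1)"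
proof -
  have "1 - 1 = (1 + \<i>) * 0" "-1 - 1 = (1 + \<i>) * (\<i> - 1)"
    "\<i> - 1 = (1 + \<i>) * \<i>" "-\<i> - 1 = (1 + \<i>) * (-1)"
    by (auto simp: complex_eq_iff)
  moreover have "{0, \<i> - 1, \<i>, -1} \<subseteq> gauss_ints" by (auto simp: gauss_ints_def)
  ultimately have "gdvd (1 + \<i>) (1 - 1)" "gdvd (1 + \<i>) (-1 - 1)"
    "gdvd (1 + \<i>) (\<i> - 1)" "gdvd (1 + \<i>) (-\<i> - 1)"
    unfolding gdvd_def by blast+
  then show ?thesis using assms unfolding gauss_units_def by blast
qed

lemma gdvd_2_Im:
  assumes "gdvd 2 z"
  obtains b :: int where "Im z = of_int (2 * b)"
proof -
  obtain w where "w \<in> gauss_ints" "z = 2 * w" using assms by (auto simp: gdvd_def)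
  then show ?thesis using that by (auto simp: gauss_ints_def elim!: Ints_cases)
qed

text \<open>For \<open>u\<close> equal to \<open>\<i>\<close> or \<open>-\<i>\<close>, the number
  \<open>u - 1\<close> has odd imaginary part.\<close>

lemma gauss_units_real_iff:
  assumes "u \<in> gauss_units"
  shows "u \<in> {1, -1} \<longleftrightarrow> gdvd 2 (u - 1)"
proof
  assume "u \<in> {1, -1}"
  then show "gdvd 2 (u - 1)" using gdvd_of_int_iff[of 2 0] gdvd_of_int_iff[of 2 "-2"] by auto
next
  assume "gdvd 2 (u - 1)"
  then obtain b :: int where "Im (u - 1) = of_int (2 * b)" by (rule gdvd_2_Im)
  moreover have "2 * b \<noteq> 1" "2 * b \<noteq> - 1" by presburger+
  then have "real_of_int (2 * b) \<noteq> of_int 1" "real_of_int (2 * b) \<noteq> of_int (- 1)"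
    by (simp_all only: of_int_eq_iff not_False_eq_True)
  ultimately show "u \<in> {1, -1}" using assms by (auto simp: gauss_units_def)
qed

text \<open>Adjoining \<open>y\<close> changes the expression by
  \<open>-(f y - 1) * (prod f B - 1)\<close>, a product of two multiples of \<open>p\<close>. The
  induction therefore also carries that the product is 1 modulo \<open>p\<close>.\<close>

lemma sum_cong_prod:
  assumes "finite A" "p \<in> gauss_ints"
    and "\<And>x. x \<in> A \<Longrightarrow> gdvd p (f x - 1)" "\<And>x. x \<in> A \<Longrightarrow> f x \<in> gauss_ints"
  shows "gdvd (p * p) (sum f A - of_nat (card A) + 1 - prod f A)"
proof -
  have "gdvd (p * p) (sum f A - of_nat (card A) + 1 - prod f A) \<and> gdvd p (prod f A - 1)"
    using assms(1,3,4)
  proof (induction A rule: finite_induct)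
    case empty
    then show ?case by (simp add: gdvd_0)
  next
    case (insert y B)
    then have IH: "gdvd (p * p) (sum f B - of_nat (card B) + 1 - prod f B)" "gdvd p (prod f B - 1)"
      by auto
    have y: "gdvd p (f y - 1)" "f y \<in> gauss_ints" using insert.prems by auto
    have "gdvd (p * p) ((sum f B - of_nat (card B) + 1 - prod f B) - (f y - 1) * (prod f B - 1))"
      by (intro gdvd_diff IH gdvd_mult_mono y)
    moreover have "gdvd p (f y * (prod f B - 1) + (f y - 1))"
      by (intro gdvd_add gdvd_mult2 IH y)
    ultimately show ?case using insert.hyps by (simp add: algebra_simps)
  qed
  then show ?thesis by blast
qed

lemma sum_cong_card:
  assumes "\<And>x. x \<in> A \<Longrightarrow> gdvd p (f x - 1)"
  shows "gdvd p (sum f A - of_nat (card A))"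
  using gdvd_sum[of A p "\<lambda>x. f x - 1"] assms by (simp add: sum_subtractf)

section \<open>Sums over the orbits of an involution\<close>

text \<open>The linear order selects the smaller element of each two-element orbit; both elements
  contribute the same term, hence the factor 2.\<close>

lemma sum_involution:
  fixes s :: "'a::linorder \<Rightarrow> 'a" and g :: "'a \<Rightarrow> 'b::comm_semiring_1"
  assumes "finite A" and s: "\<And>x. x \<in> A \<Longrightarrow> s x \<in> A" "\<And>x. x \<in> A \<Longrightarrow> s (s x) = x"
    and g: "\<And>x. x \<in> A \<Longrightarrow> g (s x) = g x"
  shows "sum g A = sum g {x\<in>A. s x = x} + 2 * sum g {x\<in>A. x < s x}"
proof -
  have "sum g {x\<in>A. s x < x} = sum g {x\<in>A. x < s x}"
    by (rule sum.reindex_bij_witness[of _ s s]) (use s g in auto)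
  moreover have A: "A = {x\<in>A. s x = x} \<union> ({x\<in>A. x < s x} \<union> {x\<in>A. s x < x})" by auto
  have "sum g A = sum g {x\<in>A. s x = x} + sum g ({x\<in>A. x < s x} \<union> {x\<in>A. s x < x})"
    by (subst A, rule sum.union_disjoint) (use \<open>finite A\<close> in auto)
  moreover have "sum g ({x\<in>A. x < s x} \<union> {x\<in>A. s x < x})
      = sum g {x\<in>A. x < s x} + sum g {x\<in>A. s x < x}"
    using \<open>finite A\<close> by (intro sum.union_disjoint) auto
  ultimately show ?thesis by (simp add: mult_2)
qed

lemma prod_involution:
  fixes s :: "'a::linorder \<Rightarrow> 'a" and g :: "'a \<Rightarrow> 'b::comm_semiring_1"
  assumes "finite A" and s: "\<And>x. x \<in> A \<Longrightarrow> s x \<in> A" "\<And>x. x \<in> A \<Longrightarrow> s (s x) = x"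
    and no_fix: "\<And>x. x \<in> A \<Longrightarrow> s x \<noteq> x"
  shows "prod g A = (\<Prod>x | x \<in> A \<and> x < s x. g x * g (s x))"
proof -
  have "prod g {x\<in>A. s x < x} = (\<Prod>x | x \<in> A \<and> x < s x. g (s x))"
    by (rule prod.reindex_bij_witness[of _ s s]) (use s in auto)
  moreover have A: "A = {x\<in>A. x < s x} \<union> {x\<in>A. s x < x}" using no_fix by (auto simp: neq_iff)
  have "prod g A = prod g {x\<in>A. x < s x} * prod g {x\<in>A. s x < x}"
    by (subst A, rule prod.union_disjoint) (use \<open>finite A\<close> in auto)
  ultimately show ?thesis by (simp add: prod.distrib)
qed

section \<open>The autocorrelation equations\<close>

text \<open>The residue of \<open>s - j\<close> modulo \<open>n\<close> for \<open>j, s < n\<close>;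
  the case distinction keeps natural subtraction from truncating.\<close>

definition refl_mod :: "nat \<Rightarrow> nat \<Rightarrow> nat \<Rightarrow> nat" where
  "refl_mod n s j = (if j \<le> s then s - j else s + n - j)"

text \<open>The matrix hypotheses in terms of the generator: \<open>c_sym\<close> is the Hermitian
  property, \<open>conv\<close> says that the off-diagonal entries in the first row of
  \<open>C * C\<close> vanish, and \<open>total\<close> is the sum of that row.\<close>

locale circ_seq =
  fixes n :: nat and d :: real and c :: "nat \<Rightarrow> complex"
  assumes d_nonneg: "d \<ge> 0" and n_ge: "n \<ge> 2"
    and d_not_odd: "\<not> (\<exists>k::int. odd k \<and> d = of_int k)"
    and c_0: "c 0 = complex_of_real d"
    and c_unit: "\<And>j. 0 < j \<Longrightarrow> j < n \<Longrightarrow> c j \<in> gauss_units"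
    and c_sym: "\<And>j. 0 < j \<Longrightarrow> j < n \<Longrightarrow> c (n - j) = cnj (c j)"
    and conv: "\<And>s. 0 < s \<Longrightarrow> s < n \<Longrightarrow> (\<Sum>j<n. c j * c (refl_mod n s j)) = 0"
    and total: "(\<Sum>j<n. c j)\<^sup>2 = complex_of_real (d\<^sup>2 + real n - 1)"
begin

text \<open>The reflection exchanges 0 and \<open>s\<close>; these two indices are split off because
  they carry the diagonal entry \<open>d\<close>.\<close>

definition rest :: "nat \<Rightarrow> nat set" where
  "rest s = {1..<n} - {s}"

definition fixpts :: "nat \<Rightarrow> nat set" where
  "fixpts s = {j\<in>rest s. refl_mod n s j = j}"

definition reps :: "nat \<Rightarrow> nat set" where
  "reps s = {j\<in>rest s. j < refl_mod n s j}"

definition pair_sum :: "nat \<Rightarrow> complex" where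
  "pair_sum s = (\<Sum>j\<in>reps s. c j * c (refl_mod n s j))"

lemma finite_rest: "finite (rest s)" and finite_reps: "finite (reps s)"
  by (auto simp: rest_def reps_def)

lemma refl_rest:
  assumes "0 < s" "s < n" "j \<in> rest s"
  shows "refl_mod n s j \<in> rest s" "refl_mod n s (refl_mod n s j) = j"
  using assms by (auto simp: rest_def refl_mod_def)

lemma rest_unit: "j \<in> rest s \<Longrightarrow> c j \<in> gauss_units"
  by (auto simp: rest_def intro: c_unit)

lemma pair_unit:
  assumes "0 < s" "s < n" "j \<in> reps s"
  shows "c j * c (refl_mod n s j) \<in> gauss_units"
  using assms refl_rest(1)[of s j] by (auto simp: reps_def intro!: gauss_units_mult rest_unit)

lemma pair_sum_ints: "0 < s \<Longrightarrow> s < n \<Longrightarrow> pair_sum s \<in> gauss_ints"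
  unfolding pair_sum_def by (intro gauss_ints_sum gauss_units_ints pair_unit)

lemma pair_sum_parity:
  "0 < s \<Longrightarrow> s < n \<Longrightarrow> gdvd (1 + \<i>) (pair_sum s - of_nat (card (reps s)))"
  unfolding pair_sum_def by (intro sum_cong_card gauss_units_cong_1 pair_unit)

text \<open>Orbit counting, that is, the orbit sum of the constant 1; the summand 2 accounts for the
  indices 0 and \<open>s\<close>.\<close>

lemma card_reps:
  assumes "0 < s" "s < n"
  shows "n = 2 + card (fixpts s) + 2 * card (reps s)"
proof -
  have "sum (\<lambda>_. 1::nat) (rest s) = sum (\<lambda>_. 1) (fixpts s) + 2 * sum (\<lambda>_. 1) (reps s)"
    unfolding fixpts_def reps_def
    by (rule sum_involution) (use assms refl_rest finite_rest in auto)
  moreover have "card (rest s) = n - 2" using assms by (simp add: rest_def)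
  ultimately show ?thesis using n_ge by simp
qed

lemma conv_rest:
  assumes "0 < s" "s < n"
  shows "2 * d * c s + (\<Sum>j\<in>rest s. c j * c (refl_mod n s j)) = 0"
proof -
  have "{..<n} = insert 0 (insert s (rest s))" "0 \<notin> insert s (rest s)" "s \<notin> rest s"
    using assms by (auto simp: rest_def)
  then have "(\<Sum>j<n. c j * c (refl_mod n s j)) =
      c 0 * c (refl_mod n s 0) + (c s * c (refl_mod n s s) + (\<Sum>j\<in>rest s. c j * c (refl_mod n s j)))"
    using finite_rest by simp
  then show ?thesis using conv[OF assms] assms by (simp add: refl_mod_def c_0 mult.assoc)
qed

lemma conv_pairs:
  assumes "0 < s" "s < n"
  shows "2 * d * c s + (\<Sum>j\<in>fixpts s. (c j)\<^sup>2) + 2 * pair_sum s = 0"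
proof -
  have "(\<Sum>j\<in>rest s. c j * c (refl_mod n s j)) =
      (\<Sum>j\<in>fixpts s. c j * c (refl_mod n s j)) + 2 * pair_sum s"
    unfolding fixpts_def reps_def pair_sum_def
    by (rule sum_involution) (use assms refl_rest finite_rest in auto)
  moreover have "(\<Sum>j\<in>fixpts s. c j * c (refl_mod n s j)) = (\<Sum>j\<in>fixpts s. (c j)\<^sup>2)"
    by (rule sum.cong) (auto simp: fixpts_def power2_eq_square)
  ultimately show ?thesis using conv_rest[OF assms] by (simp add: add.assoc)
qed

lemma conv_half:
  assumes "0 < s" "s < n" "(\<Sum>j\<in>fixpts s. (c j)\<^sup>2) = 0"
  shows "d * c s + pair_sum s = 0"
proof -
  have "2 * (d * c s + pair_sum s) = 0" using conv_pairs[OF assms(1,2)] assms(3) by (simp add: algebra_simps)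
  then show ?thesis by (metis mult_eq_0_iff zero_neq_numeral)
qed

text \<open>Fixed points solve \<open>2 * j = s\<close> modulo \<open>n\<close>, and
  \<open>j < n\<close> leaves two representatives of \<open>s\<close>.\<close>

lemma fixpts_iff:
  assumes "0 < s" "s < n"
  shows "j \<in> fixpts s \<longleftrightarrow> 2 * j = s \<or> 2 * j = s + n"
  using assms by (auto simp: fixpts_def rest_def refl_mod_def)

lemma fixpts_unit: "j \<in> fixpts s \<Longrightarrow> c j \<in> gauss_units"
  by (auto simp: fixpts_def intro: rest_unit)

subsection \<open>Odd order\<close>

text \<open>2 is invertible modulo an odd \<open>n\<close>; the parity of \<open>s\<close> decides
  whether its half is \<open>s / 2\<close> or \<open>(s + n) / 2\<close>.\<close>

lemma fixpts_odd_order: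
  assumes "odd n" "0 < s" "s < n"
  obtains h where "fixpts s = {h}"
proof (cases "even s")
  case True
  then obtain a where a: "s = 2 * a" by blast
  have "2 * j \<noteq> s + n" for j
  proof
    assume "2 * j = s + n"
    then have "even (s + n)" by (metis dvd_triv_left)
    then show False using True assms by simp
  qed
  then have "fixpts s = {a}" using fixpts_iff[OF assms(2,3)] a by (simp add: set_eq_iff)
  then show ?thesis by (rule that)
next
  case False
  then have "even (s + n)" using assms by simp
  then obtain a where a: "s + n = 2 * a" by blast
  have "2 * j \<noteq> s" for j using False by (metis dvd_triv_left)
  then have "fixpts s = {a}" using fixpts_iff[OF assms(2,3)] a by (simp add: set_eq_iff)
  then show ?thesis by (rule that)
qed

text \<open>Multiplying the equation for \<open>s = 1\<close> by the inverse
  \<open>cnj (c 1)\<close> shows that \<open>2 * d\<close> is a Gaussian integer, hence an integer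
  \<open>k\<close>. Modulo 2 the equations read \<open>k * c s = 1\<close>, so \<open>k\<close> is
  odd and \<open>c s\<close> is 1 modulo 2.\<close>

lemma odd_order_real:
  assumes "odd n"
  obtains k :: int where "odd k" "2 * d = of_int k" "\<And>s. 0 < s \<Longrightarrow> s < n \<Longrightarrow> c s \<in> {1, -1}"
proof -
  \<comment> \<open>\<open>e\<close> is the square of the entry at the single fixed point.\<close>
  have eq: "\<exists>e\<in>{1, -1}. 2 * d * c s + e + 2 * pair_sum s = 0" if s: "0 < s" "s < n" for s
  proof -
    obtain h where h: "fixpts s = {h}" using fixpts_odd_order[OF assms s] .
    then have "(c h)\<^sup>2 \<in> {1, -1}" by (intro gauss_units_square fixpts_unit[of h s]) auto
    then show ?thesis using conv_pairs[OF s] h by auto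
  qed
  have one: "0 < (1::nat)" "1 < n" using n_ge by auto
  obtain e where e: "e \<in> {1, -1}" "2 * d * c 1 + e + 2 * pair_sum 1 = 0" using eq[OF one] by blast
  have u1: "c 1 \<in> gauss_units" using c_unit one by auto
  have "e \<in> gauss_ints" "2 \<in> gauss_ints" "cnj (c 1) \<in> gauss_ints"
    using e(1) gauss_units_cnj(2)[OF u1, THEN gauss_units_ints] by (auto simp: gauss_ints_def)
  then have "(- e - 2 * pair_sum 1) * cnj (c 1) \<in> gauss_ints"
    by (intro gauss_ints_mult gauss_ints_diff gauss_ints_minus pair_sum_ints one)
  moreover have "(- e - 2 * pair_sum 1) * cnj (c 1) = complex_of_real (2 * d)"
  proof -
    have "- e - 2 * pair_sum 1 = 2 * d * c 1 - (2 * d * c 1 + e + 2 * pair_sum 1)" by simp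
    then have "- e - 2 * pair_sum 1 = 2 * d * c 1" by (simp only: e(2) diff_zero)
    then show ?thesis using gauss_units_cnj(1)[OF u1] by (simp add: mult.assoc)
  qed
  ultimately have "2 * d \<in> \<int>" using gauss_ints_of_real[of "2 * d"] by simp
  then obtain k :: int where k: "2 * d = of_int k" by (rule Ints_cases)
  have kc: "2 * complex_of_real d = of_int k"
    using arg_cong[OF k, of complex_of_real] by simp
  have cong: "gdvd 2 (of_int k * c s - 1)" if s: "0 < s" "s < n" for s
  proof -
    obtain e where e: "e \<in> {1, -1}" "of_int k * c s + e + 2 * pair_sum s = 0"
      using eq[OF s] unfolding of_real_mult of_real_numeral kc by blast
    have "gdvd 2 (- e - 1)" using e(1) gdvd_of_int_iff[of 2 0] gdvd_of_int_iff[of 2 "-2"] by auto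
    then have "gdvd 2 ((- e - 1) - 2 * pair_sum s)"
      using gdvd_triv[OF pair_sum_ints[OF s]] by (rule gdvd_diff)
    moreover have "(- e - 1) - 2 * pair_sum s =
        of_int k * c s - 1 - (of_int k * c s + e + 2 * pair_sum s)" by simp
    ultimately show ?thesis by (simp only: e(2) diff_zero)
  qed
  have odd: "odd k"
  proof
    assume "even k"
    then have "gdvd 2 (of_int k)" using gdvd_of_int_iff[of 2 k] by simp
    then have "gdvd 2 (of_int k * c 1)" using u1 by (intro gdvd_mult gauss_units_ints)
    then have "gdvd 2 (of_int k * c 1 - (of_int k * c 1 - 1))" using cong[OF one] by (rule gdvd_diff)
    then show False using gdvd_of_int_iff[of 2 1] by simp
  qed
  have "c s \<in> {1, -1}" if s: "0 < s" "s < n" for s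
  proof -
    have u: "c s \<in> gauss_units" using c_unit s by auto
    have "gdvd 2 (of_int (k - 1))" using odd gdvd_of_int_iff[of 2 "k - 1"] by simp
    then have "gdvd 2 (of_int (k - 1) * c s)" using u by (intro gdvd_mult gauss_units_ints)
    then have "gdvd 2 ((of_int k * c s - 1) - of_int (k - 1) * c s)" by (rule gdvd_diff[OF cong[OF s]])
    then have "gdvd 2 (c s - 1)" by (simp add: algebra_simps)
    then show ?thesis using gauss_units_real_iff[OF u] by simp
  qed
  then show ?thesis using that odd k by blast
qed

lemma real_pair_sum_cong:
  assumes real: "\<And>s. 0 < s \<Longrightarrow> s < n \<Longrightarrow> c s \<in> {1, -1}" and s: "0 < s" "s < n"
    and j: "j \<in> reps s"
  shows "gdvd 2 (c j * c (refl_mod n s j) - 1)"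
proof -
  have "j \<in> rest s" "refl_mod n s j \<in> rest s" using j refl_rest s by (auto simp: reps_def)
  then have "c j \<in> {1, -1}" "c (refl_mod n s j) \<in> {1, -1}" using real by (auto simp: rest_def)
  then have "c j * c (refl_mod n s j) \<in> {1, -1}" by auto
  then show ?thesis using gauss_units_real_iff pair_unit[OF s j] by blast
qed

text \<open>Real pairs are 1 modulo 2, so twice their sum is \<open>n - 3\<close> modulo 4 and
  \<open>k * c s + n - 2\<close> vanishes modulo 4. As \<open>k\<close> is odd, entries differing by
  2 are impossible. For a constant sign every product is 1, and the equation for
  \<open>s = 1\<close> becomes linear in \<open>d\<close> and \<open>n\<close>.\<close>

lemma odd_order:
  assumes "odd n"
  shows "real n = 2 * d + 2" "\<And>s. 0 < s \<Longrightarrow> s < n \<Longrightarrow> c s = -1"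
proof -
  obtain k :: int where k: "odd k" "2 * d = of_int k"
    and real: "\<And>s. 0 < s \<Longrightarrow> s < n \<Longrightarrow> c s \<in> {1, -1}" using odd_order_real[OF assms] by metis
  have kc: "2 * complex_of_real d = of_int k"
    using arg_cong[OF k(2), of complex_of_real] by simp
  have cong: "gdvd 4 (of_int k * c s + of_int (int n - 2))" if s: "0 < s" "s < n" for s
  proof -
    obtain h where h: "fixpts s = {h}" using fixpts_odd_order[OF assms s] .
    then have "h \<in> rest s" by (auto simp: fixpts_def)
    then have "(c h)\<^sup>2 = 1" using real[of h] by (auto simp: rest_def)
    then have eq: "of_int k * c s + 1 + 2 * pair_sum s = 0" using conv_pairs[OF s] h kc by simp
    have "gdvd 2 (pair_sum s - of_nat (card (reps s)))"
      unfolding pair_sum_def by (intro sum_cong_card real_pair_sum_cong real s)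
    then have "gdvd (2 * 2) (2 * (pair_sum s - of_nat (card (reps s))))"
      using gdvd_of_int_iff[of 2 2] by (intro gdvd_mult_mono) auto
    moreover have "(of_nat n :: complex) = of_nat (3 + 2 * card (reps s))"
      using card_reps[OF s] h by simp
    ultimately have "gdvd 4 (2 * pair_sum s - of_int (int n - 3))" by (simp add: algebra_simps)
    then have "gdvd 4 (- (2 * pair_sum s - of_int (int n - 3)))" by (rule gdvd_minus)
    moreover have "- (2 * pair_sum s - of_int (int n - 3)) =
        of_int k * c s + of_int (int n - 2) - (of_int k * c s + 1 + 2 * pair_sum s)"
      by (simp add: algebra_simps)
    ultimately show ?thesis by (simp only: eq diff_zero)
  qed
  have one: "0 < (1::nat)" "1 < n" using n_ge by auto
  have const: "c s = c 1" if s: "0 < s" "s < n" for s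
  proof (rule ccontr)
    assume "c s \<noteq> c 1"
    then have "c s - c 1 = 2 \<or> c s - c 1 = -2" using real[OF s] real[OF one] by auto
    moreover have "gdvd 4 ((of_int k * c s + of_int (int n - 2)) - (of_int k * c 1 + of_int (int n - 2)))"
      by (intro gdvd_diff cong s one)
    then have "gdvd 4 (of_int k * (c s - c 1))" by (simp add: algebra_simps)
    ultimately have "gdvd (of_int 4) (of_int (k * 2)) \<or> gdvd (of_int 4) (of_int (k * -2))" by auto
    then show False unfolding gdvd_of_int_iff using k(1) by presburger
  qed
  have "(\<Sum>j\<in>rest 1. c j * c (refl_mod n 1 j)) = (\<Sum>j\<in>rest 1. 1)"
  proof (rule sum.cong)
    fix j assume "j \<in> rest 1"
    then have "0 < j \<and> j < n" "0 < refl_mod n 1 j \<and> refl_mod n 1 j < n"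
      using refl_rest(1)[OF one \<open>j \<in> rest 1\<close>] by (simp_all add: rest_def)
    then have "c j = c 1" "c (refl_mod n 1 j) = c 1" using const by blast+
    then show "c j * c (refl_mod n 1 j) = 1" using real[OF one] by auto
  qed simp
  moreover have "card (rest 1) = n - 2" using n_ge by (simp add: rest_def)
  ultimately have "2 * d * c 1 + of_nat (n - 2) = 0" using conv_rest[OF one] by simp
  then have "Re (2 * d * c 1 + of_nat (n - 2)) = 0" by simp
  then have eq: "2 * d * Re (c 1) + real n - 2 = 0" using n_ge by (simp add: of_nat_diff)
  \<comment> \<open>With \<open>n > 2\<close> and \<open>d \<ge> 0\<close>, the value
    \<open>c 1 = 1\<close> would make the left side of \<open>eq\<close> positive.\<close>
  have "n \<noteq> 2" using assms by auto
  then have "real n > 2" using n_ge by linarith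
  then have u: "c 1 = -1" using eq real[OF one] d_nonneg by auto
  then show "real n = 2 * d + 2" using eq by simp
  show "c s = -1" if "0 < s" "s < n" for s using const[OF that] u by simp
qed

subsection \<open>Even order\<close>

lemma fixpts_even_order: "even n \<Longrightarrow> odd s \<Longrightarrow> 0 < s \<Longrightarrow> s < n \<Longrightarrow> fixpts s = {}"
  using fixpts_iff[of s] by (auto simp: set_eq_iff) (metis dvd_triv_left even_add)+

text \<open>At \<open>s = 1\<close> there are no fixed points, so the factor 2 cancels and
  \<open>d\<close> is a unit times a Gaussian integer. Modulo \<open>1 + \<i>\<close> every pair
  counts 1, so the number of pairs, which is \<open>m - 1\<close>, is even.\<close>

lemma even_order:
  assumes "even n"
  obtains k m where "n = 2 * m" "odd m" "d = of_int k" "even k"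
proof -
  have one: "0 < (1::nat)" "1 < n" using n_ge by auto
  have u: "c 1 \<in> gauss_units" using c_unit one by auto
  have fix0: "fixpts 1 = {}" using fixpts_even_order[of 1] assms one by simp
  then have eq: "d * c 1 + pair_sum 1 = 0"
    using conv_half[OF one] by simp
  have "- pair_sum 1 * cnj (c 1) = (d * c 1 - (d * c 1 + pair_sum 1)) * cnj (c 1)" by simp
  also have "\<dots> = d"
    unfolding eq using gauss_units_cnj(1)[OF u] by (simp add: mult.assoc)
  finally have "- pair_sum 1 * cnj (c 1) = d" .
  moreover have "- pair_sum 1 * cnj (c 1) \<in> gauss_ints"
    by (intro gauss_ints_mult gauss_ints_minus pair_sum_ints one gauss_units_ints gauss_units_cnj u)
  ultimately have "d \<in> \<int>" using gauss_ints_of_real[of d] by simp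
  then obtain k where k: "d = of_int k" by (rule Ints_cases)
  \<comment> \<open>Here the assumption that \<open>d\<close> is not an odd integer enters.\<close>
  then have even: "even k" using d_not_odd by blast
  then have "gdvd (1 + \<i>) (of_int k * c 1)"
    using gdvd_of_int_prime u by (intro gdvd_mult gauss_units_ints) auto
  then have "gdvd (1 + \<i>) (of_int k * c 1 + (pair_sum 1 - of_nat (card (reps 1))))"
    by (rule gdvd_add) (rule pair_sum_parity[OF one])
  moreover have "of_int k * c 1 + (pair_sum 1 - of_nat (card (reps 1))) =
      (d * c 1 + pair_sum 1) + of_int (- int (card (reps 1)))" by (simp add: k)
  ultimately have "gdvd (1 + \<i>) (of_int (- int (card (reps 1))))" by (simp only: eq add_0)
  then have "even (card (reps 1))" unfolding gdvd_of_int_prime by simp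
  moreover have "n = 2 * (1 + card (reps 1))" using card_reps[OF one] fix0 by simp
  ultimately show ?thesis using that[of "1 + card (reps 1)" k] k even by simp
qed

end

section \<open>Order twice an odd number: reality and values of the entries\<close>

locale circ_seq_even = circ_seq +
  fixes m :: nat and k :: int
  assumes n_eq: "n = 2 * m" and odd_m: "odd m" and d_eq: "d = of_int k" and even_k: "even k"
begin

definition P :: complex where
  "P = prod c {1..<n}"

lemma P_unit: "P \<in> gauss_units"
  unfolding P_def by (intro gauss_units_prod) (auto intro: c_unit)

lemma conv_odd:
  assumes "odd s" "0 < s" "s < n"
  shows "of_int k * c s + pair_sum s = 0" "int (card (reps s)) = int m - 1"
proof -
  have f: "fixpts s = {}" using fixpts_even_order assms n_eq by simp
  then show "of_int k * c s + pair_sum s = 0"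
    using conv_half[OF assms(2,3)] d_eq by simp
  show "int (card (reps s)) = int m - 1" using card_reps[OF assms(2,3)] f n_eq by simp
qed

text \<open>For odd \<open>s\<close> the pairs exhaust the nonzero indices other than
  \<open>s\<close>; dividing by the unit \<open>c s\<close> means multiplying by its
  conjugate.\<close>

lemma prod_pairs:
  assumes "odd s" "0 < s" "s < n"
  shows "(\<Prod>j\<in>reps s. c j * c (refl_mod n s j)) = P * cnj (c s)"
proof -
  have "fixpts s = {}" using fixpts_even_order assms n_eq by simp
  then have "prod c (rest s) = (\<Prod>j\<in>reps s. c j * c (refl_mod n s j))"
    unfolding reps_def by (intro prod_involution) (use refl_rest assms finite_rest fixpts_def in auto)
  moreover have "P = c s * prod c (rest s)"
    unfolding P_def rest_def using assms by (intro prod.remove) auto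
  ultimately show ?thesis using gauss_units_cnj(1)[OF c_unit[OF assms(2,3)]]
    by (simp add: mult.commute mult.left_commute)
qed

text \<open>The sum-product congruence replaces \<open>pair_sum s\<close> by
  \<open>card (reps s) - 1 + P * cnj (c s)\<close>. Since \<open>k\<close> and
  \<open>card (reps s) = m - 1\<close> are even, the equation leaves
  \<open>P * cnj (c s) = 1\<close> modulo 2.\<close>

lemma odd_real_aux:
  assumes s: "odd s" "0 < s" "s < n"
  shows "P * cnj (c s) \<in> {1, -1}"
proof -
  have u: "c s \<in> gauss_units" using c_unit s by auto
  have unit: "P * cnj (c s) \<in> gauss_units" by (intro gauss_units_mult P_unit gauss_units_cnj u)
  have "1 + \<i> \<in> gauss_ints" by (simp add: gauss_ints_def)
  then have "gdvd ((1 + \<i>) * (1 + \<i>)) (pair_sum s - of_nat (card (reps s)) + 1 - P * cnj (c s))"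
    unfolding pair_sum_def prod_pairs[OF s, symmetric]
    by (intro sum_cong_prod gauss_units_cong_1 gauss_units_ints[OF pair_unit] pair_unit finite_reps s)
  \<comment> \<open>The square of \<open>1 + \<i>\<close> is an associate of 2, so the congruence
    holds modulo 2.\<close>
  moreover have "(1 + \<i>) * (1 + \<i>) = 2 * \<i>" by (simp add: complex_eq_iff)
  ultimately have "gdvd (2 * \<i>) (pair_sum s - of_nat (card (reps s)) + 1 - P * cnj (c s))" by metis
  then have "gdvd 2 (pair_sum s - of_nat (card (reps s)) + 1 - P * cnj (c s))"
    by (rule gdvd_mult_left) (simp add: gauss_ints_def)
  moreover have "gdvd (of_int 2) (of_int k * c s)"
    using even_k u by (intro gdvd_mult gauss_units_ints) (auto simp only: gdvd_of_int_iff)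
  moreover have "gdvd (of_int 2) (of_int (int (card (reps s))))"
    unfolding gdvd_of_int_iff conv_odd(2)[OF s] using odd_m by simp
  ultimately have "gdvd 2 ((pair_sum s - of_nat (card (reps s)) + 1 - P * cnj (c s))
      + of_int k * c s + of_nat (card (reps s)))"
    by (intro gdvd_add) auto
  then have "gdvd 2 (- ((pair_sum s - of_nat (card (reps s)) + 1 - P * cnj (c s))
      + of_int k * c s + of_nat (card (reps s))))" by (rule gdvd_minus)
  moreover have "- ((pair_sum s - of_nat (card (reps s)) + 1 - P * cnj (c s))
      + of_int k * c s + of_nat (card (reps s))) =
      P * cnj (c s) - 1 - (of_int k * c s + pair_sum s)" by simp
  ultimately have "gdvd 2 (P * cnj (c s) - 1)" by (simp only: conv_odd(1)[OF s] diff_zero)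
  then show ?thesis using gauss_units_real_iff[OF unit] by simp
qed

text \<open>The index \<open>m\<close> is its own negative modulo \<open>n\<close>, so
  \<open>c m\<close> is real; as \<open>m\<close> is odd, this determines whether \<open>P\<close>
  is real, and \<open>P\<close> does not depend on \<open>s\<close>.\<close>

lemma P_real: "P \<in> {1, -1}"
proof -
  have m: "odd m" "0 < m" "m < n" using odd_m n_ge n_eq by auto
  have "c m \<in> gauss_units" "c m = cnj (c m)" using c_unit c_sym[of m] m n_eq by auto
  then have "c m \<in> {1, -1}" by (auto simp: gauss_units_def complex_eq_iff)
  then show ?thesis using odd_real_aux[OF m] by (auto simp: minus_equation_iff)
qed

lemma odd_real:
  assumes "odd s" "0 < s" "s < n"
  shows "c s \<in> {1, -1}"
proof -
  have "cnj (c s) \<in> {1, -1}" using odd_real_aux[OF assms] P_real by (auto simp: minus_equation_iff)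
  then show ?thesis by (auto simp: complex_eq_iff)
qed

text \<open>At \<open>s = 2 * a\<close> the fixed points \<open>a\<close> and \<open>a + m\<close>
  have different parity, so one of the squares is 1. Were the other -1, the squares would cancel,
  and the halved equation modulo \<open>1 + \<i>\<close> would make
  \<open>card (reps s) = m - 2\<close> even.\<close>

lemma even_real_aux:
  assumes a: "0 < a" "a < m"
  shows "c a \<in> {1, -1}" "c (a + m) \<in> {1, -1}"
proof -
  define s where "s = 2 * a"
  have s: "0 < s" "s < n" using a n_eq by (auto simp: s_def)
  have "j \<in> fixpts s \<longleftrightarrow> j = a \<or> j = a + m" for j
    unfolding fixpts_iff[OF s] unfolding s_def n_eq by auto
  then have f: "fixpts s = {a, a + m}" by blast
  have u: "c a \<in> gauss_units" "c (a + m) \<in> gauss_units" using c_unit a n_eq by auto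
  have "a \<noteq> a + m" using a by simp
  have odd_reps: "odd (card (reps s))"
  proof -
    have "card (fixpts s) = 2" using f \<open>a \<noteq> a + m\<close> by simp
    then have "m = 2 + card (reps s)" using card_reps[OF s] n_eq by simp
    then show ?thesis using odd_m by simp
  qed
  have "(c a)\<^sup>2 + (c (a + m))\<^sup>2 \<noteq> 0"
  proof
    assume "(c a)\<^sup>2 + (c (a + m))\<^sup>2 = 0"
    then have "(\<Sum>j\<in>fixpts s. (c j)\<^sup>2) = 0" using f \<open>a \<noteq> a + m\<close> by simp
    then have eq: "of_int k * c s + pair_sum s = 0"
      using conv_half[OF s] d_eq by simp
    have "gdvd (1 + \<i>) (of_int k * c s)"
      using even_k gdvd_of_int_prime c_unit[OF s] by (intro gdvd_mult gauss_units_ints) auto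
    then have "gdvd (1 + \<i>) (of_int k * c s + (pair_sum s - of_nat (card (reps s))))"
      by (rule gdvd_add) (rule pair_sum_parity[OF s])
    moreover have "of_int k * c s + (pair_sum s - of_nat (card (reps s))) =
        (of_int k * c s + pair_sum s) + of_int (- int (card (reps s)))" by simp
    ultimately have "gdvd (1 + \<i>) (of_int (- int (card (reps s))))" by (simp only: eq add_0)
    then show False using odd_reps unfolding gdvd_of_int_prime by simp
  qed
  moreover have "(c a)\<^sup>2 \<in> {1, -1}" "(c (a + m))\<^sup>2 \<in> {1, -1}"
    by (intro gauss_units_square u)+
  moreover have "odd a \<or> odd (a + m)" using odd_m by simp
  then have "c a \<in> {1, -1} \<or> c (a + m) \<in> {1, -1}" using odd_real[of a] odd_real[of "a + m"] a n_eq by auto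
  then have "(c a)\<^sup>2 = 1 \<or> (c (a + m))\<^sup>2 = 1" by auto
  ultimately have "(c a)\<^sup>2 = 1" "(c (a + m))\<^sup>2 = 1" by auto
  then show "c a \<in> {1, -1}" "c (a + m) \<in> {1, -1}" by (auto simp: power2_eq_1_iff)
qed

lemma all_real:
  assumes "0 < j" "j < n"
  shows "c j \<in> {1, -1}"
proof -
  consider "j < m" | "j = m" | "0 < j - m" "j - m < m" "j = (j - m) + m" using assms n_eq by linarith
  then show ?thesis
  proof cases
    case 1
    then show ?thesis using even_real_aux(1) assms by blast
  next
    case 2
    then show ?thesis using odd_real assms odd_m by blast
  next
    case 3
    then show ?thesis using even_real_aux(2)[of "j - m"] by simp
  qed
qed

text \<open>All entries being real, the sum-product congruence applies with \<open>p = 2\<close> and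
  gives \<open>(k + p) * c t = 2 - m\<close> modulo 4, where \<open>P = p\<close>. The coefficient
  \<open>k + p\<close> is odd, so the sign \<open>c t\<close> is determined.\<close>

lemma odd_const:
  assumes s: "odd s" "0 < s" "s < n"
  shows "c s = c 1"
proof (rule ccontr)
  have one: "odd (1::nat)" "0 < (1::nat)" "1 < n" using n_ge by auto
  obtain p :: int where p: "P = of_int p" "odd p"
    using P_real by (metis insertE singletonD of_int_1 of_int_minus odd_one even_minus)
  have two: "2 \<in> gauss_ints" by (simp add: gauss_ints_def)
  have cong: "gdvd 4 (of_int (2 - int m) - of_int (k + p) * c t)" if t: "odd t" "0 < t" "t < n" for t
  proof -
    have cnj: "cnj (c t) = c t" using odd_real[OF t] by auto
    have "gdvd (2 * 2) (pair_sum t - of_nat (card (reps t)) + 1 - P * cnj (c t))"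
      unfolding pair_sum_def prod_pairs[OF t, symmetric]
      by (intro sum_cong_prod real_pair_sum_cong all_real gauss_units_ints[OF pair_unit] finite_reps two t)
    moreover have "complex_of_nat (card (reps t)) = of_nat m - 1"
      using arg_cong[OF conv_odd(2)[OF t], of complex_of_int] by simp
    ultimately have "gdvd 4 (of_int (2 - int m) - of_int (k + p) * c t + (of_int k * c t + pair_sum t))"
      by (simp add: cnj p(1) algebra_simps)
    then show ?thesis by (simp only: conv_odd(1)[OF t] add_0_right)
  qed
  assume "c s \<noteq> c 1"
  then have "c s - c 1 = 2 \<or> c s - c 1 = -2" using odd_real[OF s] odd_real[OF one] by auto
  moreover have "gdvd 4 ((of_int (2 - int m) - of_int (k + p) * c 1)
      - (of_int (2 - int m) - of_int (k + p) * c s))"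
    by (rule gdvd_diff[OF cong[OF one] cong[OF s]])
  then have "gdvd 4 (of_int (k + p) * (c s - c 1))" by (simp add: algebra_simps)
  ultimately have "gdvd (of_int 4) (of_int ((k + p) * 2)) \<or> gdvd (of_int 4) (of_int ((k + p) * -2))"
    by auto
  then show False unfolding gdvd_of_int_iff using even_k p(2) by presburger
qed

lemma odd_value:
  obtains u where "u \<in> {1, -1}" "\<And>j. odd j \<Longrightarrow> j < n \<Longrightarrow> c j = u"
proof (rule that)
  show "c 1 \<in> {1, -1}" using odd_real[of 1] n_ge by simp
  show "c j = c 1" if "odd j" "j < n" for j using odd_const[OF that(1) odd_pos[OF that(1)] that(2)] .
qed

section \<open>Sums over the even and the odd indices\<close>

lemma evens: "{j. j < n \<and> even j} = (\<lambda>i. 2 * i) ` {..<m}"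
  and odds: "{j. j < n \<and> odd j} = (\<lambda>i. 2 * i + 1) ` {..<m}"
  using n_eq by (auto elim!: evenE oddE) presburger+

lemma card_evens: "card {j. j < n \<and> even j} = m" and card_odds: "card {j. j < n \<and> odd j} = m"
  unfolding evens odds by (auto simp: card_image inj_on_def)

lemma sum_parity: "(\<Sum>j<n. f j) = (\<Sum>j | j < n \<and> even j. f j) + (\<Sum>j | j < n \<and> odd j. f j :: complex)"
proof -
  have "{..<n} = {j. j < n \<and> even j} \<union> {j. j < n \<and> odd j}" by auto
  then show ?thesis by (simp add: sum.union_disjoint disjoint_iff)
qed

text \<open>The reflection for \<open>s = 1\<close> exchanges the parity classes, so each term of
  that autocorrelation has exactly one factor \<open>u\<close>; the equation is \<open>2 * u\<close>
  times the sum in question.\<close>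

lemma sum_evens: "(\<Sum>j | j < n \<and> even j. c j) = 0"
proof -
  define \<sigma> where "\<sigma> = refl_mod n 1"
  have \<sigma>: "\<sigma> j < n" "\<sigma> (\<sigma> j) = j" "even (\<sigma> j) \<longleftrightarrow> odd j" if "j < n" for j
    using that n_eq n_ge by (auto simp: \<sigma>_def refl_mod_def) presburger
  obtain u where u: "u \<in> {1, -1}" "\<And>j. odd j \<Longrightarrow> j < n \<Longrightarrow> c j = u"
    using odd_value by blast
  have "(\<Sum>j | j < n \<and> even j. c j * c (\<sigma> j)) = (\<Sum>j | j < n \<and> even j. c j * u)"
    by (rule sum.cong) (use u(2) \<sigma> in auto)
  moreover have "(\<Sum>j | j < n \<and> odd j. c j * c (\<sigma> j)) = (\<Sum>j | j < n \<and> even j. c j * u)"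
    by (rule sum.reindex_bij_witness[of _ \<sigma> \<sigma>]) (use u(2) \<sigma> in \<open>auto simp: mult.commute\<close>)
  ultimately have "2 * ((\<Sum>j | j < n \<and> even j. c j) * u) = 0"
    using conv[of 1] n_ge sum_parity[of "\<lambda>j. c j * c (\<sigma> j)"] by (simp add: \<sigma>_def sum_distrib_right)
  then show ?thesis using u(1) by auto
qed

lemma d_eq_m: "d = real m - 1"
proof -
  obtain u where u: "u \<in> {1, -1}" "\<And>j. odd j \<Longrightarrow> j < n \<Longrightarrow> c j = u"
    using odd_value by blast
  then have "(\<Sum>j | j < n \<and> odd j. c j) = (\<Sum>j | j < n \<and> odd j. u)"
    by (intro sum.cong) auto
  then have "(\<Sum>j<n. c j) = of_nat m * u" using sum_parity[of c] sum_evens card_odds by simp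
  moreover have "u\<^sup>2 = 1" using u(1) by auto
  ultimately have "complex_of_real ((real m)\<^sup>2) = complex_of_real (d\<^sup>2 + real n - 1)"
    using total by (simp add: power_mult_distrib)
  then have "(real m)\<^sup>2 = d\<^sup>2 + real n - 1" by (simp only: of_real_eq_iff)
  \<comment> \<open>Substituting \<open>n = 2 * m\<close> completes the square.\<close>
  then have "d\<^sup>2 = (real m - 1)\<^sup>2" by (simp add: n_eq power2_eq_square algebra_simps)
  moreover have "real m - 1 \<ge> 0" using odd_m by (cases m) auto
  ultimately show ?thesis using d_nonneg by (simp add: power2_eq_iff_nonneg)
qed

lemma even_value:
  assumes "even j" "0 < j" "j < n"
  shows "c j = -1"
proof -
  define A where "A = {j. j < n \<and> even j} - {0}"
  have fin: "finite {j. j < n \<and> even j}" by simp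
  have z: "0 \<in> {j. j < n \<and> even j}" using n_ge by simp
  have A: "finite A" "card A = m - 1" using z fin by (simp_all add: A_def card_evens)
  have "c 0 + sum c A = 0" using sum.remove[OF fin z, of c] sum_evens by (simp add: A_def)
  then have "sum c A = - complex_of_real d" using c_0 by (simp add: eq_neg_iff_add_eq_0 add.commute)
  then have "Re (sum c A) = - d" by (simp del: Re_sum)
  moreover have "m \<ge> 1" using odd_m by (cases m) auto
  \<comment> \<open>The \<open>m - 1\<close> signs sum to \<open>-(m - 1)\<close>, so the
    nonnegative numbers \<open>Re (c j) + 1\<close> sum to 0 and each vanishes.\<close>
  ultimately have sum0: "(\<Sum>j\<in>A. Re (c j) + 1) = 0" using A d_eq_m by (simp add: sum.distrib of_nat_diff)
  have r: "c j \<in> {1, -1}" if "j \<in> A" for j using that all_real by (auto simp: A_def)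
  then have "Re (c j) + 1 \<ge> 0" if "j \<in> A" for j using that by fastforce
  then have "\<forall>j\<in>A. Re (c j) + 1 = 0"
    using sum_nonneg_eq_0_iff[OF A(1), of "\<lambda>j. Re (c j) + 1"] sum0 by blast
  moreover have "j \<in> A" using assms by (simp add: A_def)
  ultimately show ?thesis using r[of j] by auto
qed

end

section \<open>Circulant matrices\<close>

lemma circ_index: "r < n \<Longrightarrow> s < n \<Longrightarrow> circ n c $$ (r, s) = c (nat ((int s - int r) mod int n))"
  by (simp add: circ_def)

lemma circ_dim: "dim_row (circ n c) = n" "dim_col (circ n c) = n"
  by (simp_all add: circ_def)

lemma circ_cong:
  assumes "\<And>j. j < n \<Longrightarrow> c j = c' j"
  shows "circ n c = circ n c'"
proof (cases "n = 0")
  case False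
  then have "nat (x mod int n) < n" for x by (simp add: nat_less_iff)
  then show ?thesis unfolding circ_def using assms by (auto intro!: eq_matI)
qed (auto simp: circ_def)

text \<open>Each row is a cyclic shift of the generator.\<close>

lemma circ_row_sum:
  assumes "k < n"
  shows "(\<Sum>s<n. circ n c $$ (k, s)) = (\<Sum>j<n. c j)"
proof -
  have n: "0 < int n" using assms by simp
  have "(\<Sum>s<n. circ n c $$ (k, s)) = (\<Sum>s<n. c (nat ((int s - int k) mod int n)))"
    using assms by (intro sum.cong) (auto simp: circ_index)
  also have "\<dots> = (\<Sum>j<n. c j)"
  proof (rule sum.reindex_bij_witness[of _ "\<lambda>j. nat ((int j + int k) mod int n)"
          "\<lambda>s. nat ((int s - int k) mod int n)"])
    fix s assume "s \<in> {..<n}"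
    then show "nat ((int (nat ((int s - int k) mod int n)) + int k) mod int n) = s"
      using n by (simp add: mod_simps)
    show "nat ((int s - int k) mod int n) \<in> {..<n}" using n by (simp add: nat_less_iff)
  next
    fix j assume "j \<in> {..<n}"
    then show "nat ((int (nat ((int j + int k) mod int n)) - int k) mod int n) = j"
      using n by (simp add: mod_simps)
    show "nat ((int j + int k) mod int n) \<in> {..<n}" using n by (simp add: nat_less_iff)
  qed simp
  finally show ?thesis .
qed

lemma circ_square_index:
  assumes "s < n"
  shows "(circ n c * circ n c) $$ (0, s) = (\<Sum>j<n. c j * circ n c $$ (j, s))"
  using assms by (simp add: scalar_prod_def circ_dim circ_index lessThan_atLeast0)

lemma circ_refl_mod:
  assumes "j < n" "s < n"
  shows "circ n c $$ (j, s) = c (refl_mod n s j)"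
proof -
  have "(int s - int j) mod int n = int (refl_mod n s j)"
  proof (cases "j \<le> s")
    case True
    then show ?thesis using assms by (simp add: refl_mod_def of_nat_diff)
  next
    case False
    have "(int s - int j) mod int n = (int s - int j + int n) mod int n" by simp
    also have "\<dots> = int s - int j + int n" using False assms by (intro mod_pos_pos_trivial) auto
    finally show ?thesis using False assms by (simp add: refl_mod_def of_nat_diff)
  qed
  then show ?thesis using assms by (simp add: circ_index)
qed

text \<open>For Hermitian \<open>C\<close> the product with the adjoint is \<open>C * C\<close>; its
  first row contains the autocorrelations of the generator.\<close>

lemma circ_seqI:
  fixes d :: real and c :: "nat \<Rightarrow> complex"
  assumes "d \<ge> 0" "\<not> (\<exists>k::int. odd k \<and> d = of_int k)" "n \<ge> 2"
    and herm: "hermitian (circ n c)" and "c 0 = complex_of_real d"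
    and "\<forall>j\<in>{1..n - 1}. c j \<in> {1, -1, \<i>, -\<i>}"
    and orth: "circ n c * mat_adjoint (circ n c) = complex_of_real (d\<^sup>2 + real n - 1) \<cdot>\<^sub>m 1\<^sub>m n"
  shows "circ_seq n d c"
proof
  have sq: "circ n c * circ n c = complex_of_real (d\<^sup>2 + real n - 1) \<cdot>\<^sub>m 1\<^sub>m n"
    using herm orth by (simp add: hermitian_def)
  have entry: "(\<Sum>j<n. c j * circ n c $$ (j, s)) =
      (if s = 0 then complex_of_real (d\<^sup>2 + real n - 1) else 0)" if "s < n" for s
    using circ_square_index[OF that, of c] that unfolding sq by (auto simp: if_distrib)
  show "(\<Sum>j<n. c j * c (refl_mod n s j)) = 0" if "0 < s" "s < n" for s
    using entry[of s] that by (simp add: circ_refl_mod)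
  \<comment> \<open>Since all row sums of \<open>C\<close> agree, the first row of
    \<open>C * C\<close> sums to the square of this common value.\<close>
  have "(\<Sum>j<n. c j)\<^sup>2 = (\<Sum>j<n. c j * (\<Sum>s<n. circ n c $$ (j, s)))"
    by (simp add: circ_row_sum power2_eq_square sum_distrib_right)
  also have "\<dots> = (\<Sum>s<n. \<Sum>j<n. c j * circ n c $$ (j, s))"
    unfolding sum_distrib_left by (rule sum.swap)
  also have "\<dots> = (\<Sum>s<n. if s = 0 then complex_of_real (d\<^sup>2 + real n - 1) else 0)"
    by (rule sum.cong) (simp_all add: entry)
  also have "\<dots> = complex_of_real (d\<^sup>2 + real n - 1)" using \<open>n \<ge> 2\<close> by simp
  finally show "(\<Sum>j<n. c j)\<^sup>2 = complex_of_real (d\<^sup>2 + real n - 1)" .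
  show "c j \<in> gauss_units" if "0 < j" "j < n" for j
    using assms(6) that by (simp add: gauss_units_def)
  show "c (n - j) = cnj (c j)" if j: "0 < j" "j < n" for j
  proof -
    have "mat_adjoint (circ n c) $$ (j, 0) = cnj (circ n c $$ (0, j))"
      using j by (simp add: mat_adjoint_def circ_dim mat_of_rows_index)
    then have "circ n c $$ (j, 0) = cnj (circ n c $$ (0, j))" using herm by (simp add: hermitian_def)
    then show ?thesis using j circ_refl_mod[of j n 0 c] circ_refl_mod[of 0 n j c]
      by (simp add: refl_mod_def)
  qed
qed (use assms in auto)

section \<open>Assembly of the odd and the even case\<close>

theorem theorem1:
  fixes d :: real and n :: nat and c :: "nat \<Rightarrow> complex" and C :: "complex mat"
  assumes "d \<ge> 0"
    and "\<not> (\<exists>k::int. odd k \<and> d = of_int k)"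
    and "n \<ge> 2"
    and "C = circ n c"
    and "hermitian C"
    and "c 0 = complex_of_real d"
    and "\<forall>j\<in>{1..n - 1}. c j \<in> {1, -1, \<i>, -\<i>}"
    and "C * mat_adjoint C = complex_of_real (d\<^sup>2 + real n - 1) \<cdot>\<^sub>m 1\<^sub>m n"
  shows "real n = 2 * d + 2
    \<and> elements_mat C \<subseteq> \<real>
    \<and> ((\<exists>k::int. even k \<and> d = of_int k) \<longrightarrow>
         C = circ n (\<lambda>j. if j = 0 then complex_of_real d else -1)
         \<or> C = circ n (\<lambda>j. if j = 0 then complex_of_real d else (-1) ^ (j + 1)))
    \<and> (half_integer d \<longrightarrow>
         C = circ n (\<lambda>j. if j = 0 then complex_of_real d else -1))"
proof -
  interpret circ_seq n d c using assms circ_seqI by blast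
  have real: "elements_mat C \<subseteq> \<real>" if "\<And>j. 0 < j \<Longrightarrow> j < n \<Longrightarrow> c j \<in> {1, -1}"
  proof
    fix x assume "x \<in> elements_mat C"
    then obtain r s where "r < n" "s < n" "x = C $$ (r, s)"
      using assms(4) by (auto simp: circ_dim dest!: elements_matD)
    then have "x = c (refl_mod n s r)" "refl_mod n s r < n"
      using assms(4) by (auto simp: circ_refl_mod) (auto simp: refl_mod_def)
    then show "x \<in> \<real>" using that[of "refl_mod n s r"] c_0 by (cases "refl_mod n s r = 0") auto
  qed
  show ?thesis
  proof (cases "even n")
    case False
    then have v: "real n = 2 * d + 2" "\<And>s. 0 < s \<Longrightarrow> s < n \<Longrightarrow> c s = -1" using odd_order by auto
    moreover have "C = circ n (\<lambda>j. if j = 0 then complex_of_real d else -1)"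
      unfolding assms(4) using v(2) c_0 by (intro circ_cong) auto
    moreover have "elements_mat C \<subseteq> \<real>" using v(2) by (intro real) auto
    ultimately show ?thesis by blast
  next
    case True
    then obtain k m where km: "n = 2 * m" "odd m" "d = of_int k" "even k" by (rule even_order)
    interpret circ_seq_even n d c m k by unfold_locales (fact km)+
    \<comment> \<open>For even \<open>n\<close> the number \<open>d\<close> is an integer, so the
      half-integer clause is vacuous.\<close>
    have "\<not> half_integer d"
    proof
      assume "half_integer d"
      then obtain l :: int where "odd l" "2 * d = of_int l" by (auto simp: half_integer_def)
      then have "real_of_int (2 * k) = of_int l" using km(3) by simp
      then have "2 * k = l" by (simp only: of_int_eq_iff)
      then show False using \<open>odd l\<close> by auto
    qed
    moreover have "real n = 2 * d + 2" using d_eq_m km(1) by simp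
    moreover have "elements_mat C \<subseteq> \<real>" by (rule real) (rule all_real)
    moreover obtain u where u: "u \<in> {1, -1}" "\<And>j. odd j \<Longrightarrow> j < n \<Longrightarrow> c j = u"
      using odd_value by blast
    have "C = circ n (\<lambda>j. if j = 0 then complex_of_real d else -1)
         \<or> C = circ n (\<lambda>j. if j = 0 then complex_of_real d else (-1) ^ (j + 1))"
    \<comment> \<open>Entries of nonzero even index are -1, so the sign \<open>u\<close> at odd
      indices decides between the alternating and the constant generator.\<close>
    proof (cases "u = 1")
      case True
      have "circ n c = circ n (\<lambda>j. if j = 0 then complex_of_real d else (-1) ^ (j + 1))"
      proof (rule circ_cong)
        fix j assume "j < n"
        then show "c j = (if j = 0 then complex_of_real d else (-1) ^ (j + 1))"
          using even_value[of j] u(2)[of j] c_0 True by (cases "even j") auto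
      qed
      then show ?thesis using assms(4) by blast
    next
      case False
      have "circ n c = circ n (\<lambda>j. if j = 0 then complex_of_real d else -1)"
      proof (rule circ_cong)
        fix j assume "j < n"
        then show "c j = (if j = 0 then complex_of_real d else -1)"
          using even_value[of j] u(2)[of j] c_0 u(1) False by (cases "even j") auto
      qed
      then show ?thesis using assms(4) by blast
    qed
    ultimately show ?thesis by blast
  qed
qed

end
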